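(* The virtual singular twin monoid $VSTM_n$ admits the following reduced presentation, with generators $\nu_1,\nu_2,\dots,\nu_{n-1}$ and the connecting strings $\mu_1,\gamma_1$ (with $\mu_1$ invertible, with inverse $\mu_1^{-1}$), and relations: 1. $\nu_i^2=1$ for all $i$, and $\mu_1\mu_1^{-1}=1=\mu_1^{-1}\mu_1$; 2. $\nu_i\nu_j\nu_i=\nu_j\nu_i\nu_j$ for $|i-j|=1$; 3. $(\nu_1\nu_2\mu_1\nu_2\nu_1)(\nu_2\mu_1\nu_2)\gamma_1=\gamma_1(\nu_2\mu_1\nu_2)(\nu_1\nu_2\mu_1\nu_2\nu_1)$; 4. $\mu_1\nu_1\gamma_1=\gamma_1\nu_1\mu_1$; 5. $\nu_i\nu_j=\nu_j\nu_i$ for $|i-j|\ge2$; 6. $\mu_1\nu_i=\nu_i\mu_1$ and $\gamma_1\nu_i=\nu_i\gamma_1$ for $i\ge3$; 7. $\gamma_1(\nu_2\nu_1\nu_3\nu_2\gamma_1\nu_2\nu_3\nu_1\nu_2)=(\nu_2\nu_1\nu_3\nu_2\gamma_1\nu_2\nu_3\nu_1\nu_2)\gamma_1$; 8. $\gamma_1(\nu_2\nu_1\nu_3\nu_2\mu_1\nu_2\nu_3\nu_1\nu_2)=(\nu_2\nu_1\nu_3\nu_2\mu_1\nu_2\nu_3\nu_1\nu_2)\gamma_1$; 9. $\mu_1(\nu_2\nu_1\nu_3\nu_2\mu_1\nu_2\nu_3\nu_1\nu_2)=(\nu_2\nu_1\nu_3\nu_2\mu_1\nu_2\nu_3\nu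_1\nu_2)\mu_1$.
   Context: The virtual singular twin monoid $VSTM_n$ is the monoid generated by $s_i,\tau_i,\nu_i$ ($1\le i\le n-1$) subject to: $s_i^2=1$, $\nu_i^2=1$ and $\tau_is_i=s_i\tau_i$ for all $i$; $s_is_j\tau_i=\tau_js_is_j$, $\nu_i\nu_j\nu_i=\nu_j\nu_i\nu_j$, $\nu_is_j\nu_i=\nu_js_i\nu_j$, $\nu_i\tau_j\nu_i=\nu_j\tau_i\nu_j$ for $|i-j|=1$; and $g_ih_j=h_jg_i$ for $|i-j|\ge 2$, where $g_i,h_i\in\{s_i,\tau_i,\nu_i\}$. The connecting strings are the elements $\mu_i:=s_i\nu_i$ and $\gamma_i:=\tau_i\nu_i$ of $VSTM_n$ ($1\le i\le n-1$), so $\mu_1=s_1\nu_1$, $\gamma_1=\tau_1\nu_1$ and $\mu_1^{-1}=\nu_1s_1$. In the reduced presentation the other connecting strings are expressed, for $1\le i\le n-2$, by $\mu_{i+1}=(\nu_i\cdots\nu_1)(\nu_{i+1}\cdots\nu_3\nu_2)\mu_1(\nu_2\nu_3\cdots\nu_{i+1})(\nu_1\nu_2\cdots\nu_i)$ and $\gamma_{i+1}=(\nu_i\cdots\nu_1)(\nu_{i+1}\cdots\nu_3\nu_2)\gamma_1(\nu_2\nu_3\cdots\nu_{i+1})(\nu_1\nu_2\cdots\nu_i)$. All generator indices range over $1,\dots,n-1$; a relation is imposed only when all the generators occurring in it exist for the given $n$.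
   Formalization: In relation 1, μ_1^{-1} is read as the word ν_1μ_1ν_1 (= ν_1s_1 with s_1 = μ_1ν_1), so that (μ_1ν_1)^2=1; with a merely formal inverse the claim fails for all n≥2, since μ_1↦1, ν_i,γ_1↦0 would define a homomorphism to the integers. *)

theory Defs
  imports "HOL-Algebra.Group"
begin

section \<open>Monoid presentations\<close>

text \<open>
  The congruence generated by the relations in \<open>R\<close> on the free monoid of words over \<open>A\<close>.
  Relations mentioning a letter outside \<open>A\<close> are ignored. This is how families of relations indexed
  by all natural numbers are cut down below to those whose generators all exist.
\<close>

inductive_set word_cong :: "'a set \<Rightarrow> ('a list \<times> 'a list) set \<Rightarrow> ('a list \<times> 'a list) set"
  for A R where
  rel: "(u, v) \<in> R \<Longrightarrow> u \<in> lists A \<Longrightarrow> v \<in> lists A \<Longrightarrow> (u, v) \<in> word_cong A R"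
| refl: "u \<in> lists A \<Longrightarrow> (u, u) \<in> word_cong A R"
| sym: "(u, v) \<in> word_cong A R \<Longrightarrow> (v, u) \<in> word_cong A R"
| trans: "(u, v) \<in> word_cong A R \<Longrightarrow> (v, w) \<in> word_cong A R \<Longrightarrow> (u, w) \<in> word_cong A R"
| append: "(u, v) \<in> word_cong A R \<Longrightarrow> (u', v') \<in> word_cong A R \<Longrightarrow> (u @ u', v @ v') \<in> word_cong A R"

definition word_class :: "'a set \<Rightarrow> ('a list \<times> 'a list) set \<Rightarrow> 'a list \<Rightarrow> 'a list set" where
  "word_class A R w = word_cong A R `` {w}"

definition presented_monoid :: "'a set \<Rightarrow> ('a list \<times> 'a list) set \<Rightarrow> 'a list set monoid" where
  "presented_monoid A R =
    \<lparr>carrier = lists A // word_cong A R,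
     mult = (\<lambda>X Y. \<Union>u\<in>X. \<Union>v\<in>Y. word_class A R (u @ v)),
     one = word_class A R []\<rparr>"

text \<open>
  The monoid \<open>M\<close> is presented by generators \<open>A\<close> and relations \<open>R\<close>, the letter \<open>a\<close> standing for
  the element \<open>g a\<close> of \<open>M\<close>.
\<close>

definition admits_presentation ::
    "('b, 'c) monoid_scheme \<Rightarrow> ('a \<Rightarrow> 'b) \<Rightarrow> 'a set \<Rightarrow> ('a list \<times> 'a list) set \<Rightarrow> bool" where
  "admits_presentation M g A R \<longleftrightarrow>
    (\<exists>f \<in> iso (presented_monoid A R) M. \<forall>a\<in>A. f (word_class A R [a]) = g a)"

lemma word_cong_in_lists:
  "(u, v) \<in> word_cong A R \<Longrightarrow> u \<in> lists A \<and> v \<in> lists A"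
  by (induction rule: word_cong.induct) auto

lemma equiv_word_cong: "equiv (lists A) (word_cong A R)"
proof (rule equivI)
  show "word_cong A R \<subseteq> lists A \<times> lists A"
    using word_cong_in_lists by fast
  show "refl_on (lists A) (word_cong A R)"
    by (rule refl_onI) (rule word_cong.refl)
  show "sym (word_cong A R)"
    by (rule symI) (rule word_cong.sym)
  show "trans (word_cong A R)"
    by (rule transI) (rule word_cong.trans)
qed

lemma word_class_mult:
  assumes "u \<in> lists A" "v \<in> lists A"
  shows "word_class A R u \<otimes>\<^bsub>presented_monoid A R\<^esub> word_class A R v = word_class A R (u @ v)"
proof -
  have "word_class A R (u' @ v') = word_class A R (u @ v)"
    if "u' \<in> word_class A R u" "v' \<in> word_class A R v" for u' v'
    using that unfolding word_class_def
    by (intro equiv_class_eq[OF equiv_word_cong] word_cong.append) (simp_all add: word_cong.sym)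
  moreover have "u \<in> word_class A R u" "v \<in> word_class A R v"
    using assms by (simp_all add: word_class_def word_cong.refl)
  ultimately have "(\<Union>u'\<in>word_class A R u. \<Union>v'\<in>word_class A R v. word_class A R (u' @ v'))
      = word_class A R (u @ v)"
    by blast
  then show ?thesis
    by (simp add: presented_monoid_def)
qed

lemma carrier_presented_monoid:
  "carrier (presented_monoid A R) = word_class A R ` lists A"
  by (auto simp: presented_monoid_def quotient_def word_class_def)

lemma monoid_presented_monoid: "monoid (presented_monoid A R)"
proof -
  have one: "\<one>\<^bsub>presented_monoid A R\<^esub> = word_class A R []"
    by (simp add: presented_monoid_def)
  have app: "u @ v \<in> lists A" if "u \<in> lists A" "v \<in> lists A" for u v
    using that by simp
  show ?thesis
    by (rule monoidI; unfold carrier_presented_monoid one; (elim imageE)?;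
        simp only: word_class_mult app lists.Nil append_assoc append_Nil append_Nil2 imageI)
qed


section \<open>The virtual singular twin monoid\<close>

datatype vstm_gen = Sg nat | Tau nat | Nu nat

definition vstm_gens :: "nat \<Rightarrow> vstm_gen set" where
  "vstm_gens n = Sg ` {1..n-1} \<union> Tau ` {1..n-1} \<union> Nu ` {1..n-1}"

definition vstm_rels :: "(vstm_gen list \<times> vstm_gen list) set" where
  "vstm_rels =
     {([Sg i, Sg i], []) |i. True}
   \<union> {([Nu i, Nu i], []) |i. True}
   \<union> {([Tau i, Sg i], [Sg i, Tau i]) |i. True}
   \<union> {([Sg i, Sg j, Tau i], [Tau j, Sg i, Sg j]) |i j. \<bar>int i - int j\<bar> = 1}
   \<union> {([Nu i, Nu j, Nu i], [Nu j, Nu i, Nu j]) |i j. \<bar>int i - int j\<bar> = 1}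
   \<union> {([Nu i, Sg j, Nu i], [Nu j, Sg i, Nu j]) |i j. \<bar>int i - int j\<bar> = 1}
   \<union> {([Nu i, Tau j, Nu i], [Nu j, Tau i, Nu j]) |i j. \<bar>int i - int j\<bar> = 1}
   \<union> {([g i, h j], [h j, g i]) |g h i j.
        g \<in> {Sg, Tau, Nu} \<and> h \<in> {Sg, Tau, Nu} \<and> \<bar>int i - int j\<bar> \<ge> 2}"

definition VSTM :: "nat \<Rightarrow> vstm_gen list set monoid" where
  "VSTM n = presented_monoid (vstm_gens n) vstm_rels"

abbreviation vstm_elem :: "nat \<Rightarrow> vstm_gen list \<Rightarrow> vstm_gen list set" where
  "vstm_elem n w \<equiv> word_class (vstm_gens n) vstm_rels w"


section \<open>The reduced presentation\<close>

datatype red_gen = N nat | M1 | G1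

text \<open>The letters \<open>N i\<close>, \<open>M1\<close>, \<open>G1\<close> stand for $\nu_i$, $\mu_1 = s_1\nu_1$, $\gamma_1 = \tau_1\nu_1$.\<close>

primrec connecting_string :: "nat \<Rightarrow> red_gen \<Rightarrow> vstm_gen list set" where
  "connecting_string n (N i) = vstm_elem n [Nu i]"
| "connecting_string n M1 = vstm_elem n [Sg 1, Nu 1]"
| "connecting_string n G1 = vstm_elem n [Tau 1, Nu 1]"

text \<open>$\mu_1$ and $\gamma_1$ exist only if the index 1 lies in the range $1,\dots,n-1$.\<close>

definition red_gens :: "nat \<Rightarrow> red_gen set" where
  "red_gens n = N ` {1..n-1} \<union> (if n \<ge> 2 then {M1, G1} else {})"

text \<open>
  The inverse of $\mu_1$ is not a further free generator but the element $\nu_1 s_1$, where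
  $s_1 = \mu_1\nu_1$. With a merely formal inverse of $\mu_1$ the relations below would not imply
  $s_1^2 = 1$: they would admit a homomorphism to the integers taking $\mu_1$ to 1 and the other
  generators to 0.
\<close>

definition s1_word :: "red_gen list" where
  "s1_word = [M1, N 1]"

definition mu1_inv :: "red_gen list" where
  "mu1_inv = [N 1] @ s1_word"

definition red_rels :: "(red_gen list \<times> red_gen list) set" where
  "red_rels =
     {([N i, N i], []) |i. True}
   \<union> {([M1] @ mu1_inv, []), ([], mu1_inv @ [M1])}
   \<union> {([N i, N j, N i], [N j, N i, N j]) |i j. \<bar>int i - int j\<bar> = 1}
   \<union> {([N 1, N 2, M1, N 2, N 1] @ [N 2, M1, N 2] @ [G1],
       [G1] @ [N 2, M1, N 2] @ [N 1, N 2, M1, N 2, N 1])}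
   \<union> {([M1, N 1, G1], [G1, N 1, M1])}
   \<union> {([N i, N j], [N j, N i]) |i j. \<bar>int i - int j\<bar> \<ge> 2}
   \<union> {([M1, N i], [N i, M1]) |i. i \<ge> 3}
   \<union> {([G1, N i], [N i, G1]) |i. i \<ge> 3}
   \<union> {([G1] @ [N 2, N 1, N 3, N 2, G1, N 2, N 3, N 1, N 2],
       [N 2, N 1, N 3, N 2, G1, N 2, N 3, N 1, N 2] @ [G1])}
   \<union> {([G1] @ [N 2, N 1, N 3, N 2, M1, N 2, N 3, N 1, N 2],
       [N 2, N 1, N 3, N 2, M1, N 2, N 3, N 1, N 2] @ [G1])}
   \<union> {([M1] @ [N 2, N 1, N 3, N 2, M1, N 2, N 3, N 1, N 2],
       [N 2, N 1, N 3, N 2, M1, N 2, N 3, N 1, N 2] @ [M1])}"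

end

theory Submission
  imports Defs
begin

text \<open>
  The relation $\nu_i s_{i+1}\nu_i = \nu_{i+1}s_i\nu_{i+1}$ determines $s_{i+1}$ as the conjugate
  $(\nu_i\nu_{i+1})\,s_i\,(\nu_{i+1}\nu_i)$, and likewise for $\tau$. So the monoid is generated by
  the $\nu_i$ together with $s_1 = \mu_1\nu_1$ and $\tau_1 = \gamma_1\nu_1$. What has to be seen is
  that, for families defined by this recursion, all relations of the original presentation follow
  from their instances of lowest index.

  The $\nu_i$ generate a quotient of a symmetric group. If $s_1$ commutes with $\nu_k$ for all
  $k \ge 3$, then the conjugates of $s_1$ behave like elements indexed by the pairs $(i,i+1)$, permuted
  by the $\nu$'s: $s_i$ commutes with every distant $\nu_k$ (\<open>commute_nu\<close>), and conjugation by
  $\nu_i\nu_{i+1}\nu_{i+2}$ shifts $s_i$ and $s_{i+1}$ to $s_{i+1}$ and $s_{i+2}$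
  (\<open>shift_intertwines\<close>). Hence the relations in one or two neighbouring indices propagate from the
  index 1. Commutation at distance propagates from the single pair $(1,3)$
  (\<open>conjugate_families_commute\<close>), and the commutation of $s_1$ with $\tau_3$ results from that of
  $\tau_1$ with $s_3$ by conjugation with $\nu_2\nu_1\nu_3\nu_2$, which exchanges the indices 1 and 3.

  The relations of lowest index become the reduced relations under the substitution
  $s_1 = \mu_1\nu_1$, $\tau_1 = \gamma_1\nu_1$, up to a product of $\nu$'s that can be cancelled on the
  right: $s_1^2 = 1$ says that $\nu_1s_1$ is inverse to $\mu_1$; $s_1\tau_1 = \tau_1s_1$ is
  $\mu_1\nu_1\gamma_1 = \gamma_1\nu_1\mu_1$; $s_2s_1\tau_2 = \tau_1s_2s_1$ is the relation between
  $\nu_1\nu_2\mu_1\nu_2\nu_1 = \mu_2$, $\nu_2\mu_1\nu_2$ and $\gamma_1$; and the commutation of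
  indices 1 and 3 is that of $\mu_1$, $\gamma_1$ with their conjugates by $\nu_2\nu_1\nu_3\nu_2$
  (\<open>reduced_action_iff_twin_action\<close>).

  All computations take place in actions. Two words are congruent if and only if they act alike
  whenever the generators act by functions that satisfy the relations, because the words modulo the
  congruence carry such an action themselves. An identity between words becomes
  an identity between nested function applications, in which associativity is built in.
\<close>

section \<open>Presentations and actions\<close>

text \<open>
  A word acts by composing the functions of its letters, the last letter being applied first. As for
  presentations, only the relations between words over \<open>A\<close> count.
\<close>

definition satisfies :: "('a \<Rightarrow> 'x \<Rightarrow> 'x) \<Rightarrow> 'a set \<Rightarrow> ('a list \<times> 'a list) set \<Rightarrow> bool" where
  "satisfies f A R \<longleftrightarrow> (\<forall>(u, v)\<in>R. u \<in> lists A \<longrightarrow> v \<in> lists A \<longrightarrow> foldr f u = foldr f v)"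

lemma satisfies_Un: "satisfies f A (R \<union> S) \<longleftrightarrow> satisfies f A R \<and> satisfies f A S"
  unfolding satisfies_def by blast

lemma satisfiesD:
  assumes "satisfies f A R" "(u, v) \<in> R" "u \<in> lists A" "v \<in> lists A"
  shows "foldr f u y = foldr f v y"
  using assms unfolding satisfies_def by fastforce

lemma satisfiesI:
  assumes "\<And>u v y. (u, v) \<in> R \<Longrightarrow> u \<in> lists A \<Longrightarrow> v \<in> lists A \<Longrightarrow> foldr f u y = foldr f v y"
  shows "satisfies f A R"
  using assms unfolding satisfies_def by fastforce

lemma word_cong_imp_foldr_eq:
  assumes "(u, v) \<in> word_cong A R" "satisfies f A R"
  shows "foldr f u = foldr f v"
  using assms(1)
proof (induction rule: word_cong.induct)
  case (rel u v)
  then show ?case using assms(2) by (auto simp: satisfies_def)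
next
  case (append u v u' v')
  then show ?case by simp
qed simp_all

text \<open>
  The witness is left multiplication on the presented monoid, continued by the identity to all other
  sets of words; the class of the empty word recovers the class of a word from its action.
\<close>

lemma foldr_eq_imp_word_cong:
  fixes A :: "'a set"
  assumes u: "u \<in> lists A" and v: "v \<in> lists A"
    and eq: "\<And>f :: 'a \<Rightarrow> 'a list set \<Rightarrow> 'a list set. satisfies f A R \<Longrightarrow> foldr f u = foldr f v"
  shows "(u, v) \<in> word_cong A R"
proof -
  let ?C = "word_class A R"
  define f where "f a X = (if X \<in> ?C ` lists A
      then ?C [a] \<otimes>\<^bsub>presented_monoid A R\<^esub> X else X)" for a X
  have f_class: "foldr f p (?C w) = ?C (p @ w)" if "p \<in> lists A" "w \<in> lists A" for p w
    using that by (induction p) (auto simp: f_def word_class_mult)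
  have f_other: "foldr f p X = X" if "X \<notin> ?C ` lists A" for p X
    using that by (induction p) (auto simp: f_def)
  have class_eq: "?C p = ?C q" if "(p, q) \<in> word_cong A R" for p q
    unfolding word_class_def by (rule equiv_class_eq[OF equiv_word_cong that])
  have "satisfies f A R"
  proof (rule satisfiesI)
    fix p q X assume pq: "(p, q) \<in> R" "p \<in> lists A" "q \<in> lists A"
    show "foldr f p X = foldr f q X"
    proof (cases "X \<in> ?C ` lists A")
      case True
      then obtain w where w: "w \<in> lists A" "X = ?C w" by blast
      have "?C (p @ w) = ?C (q @ w)"
        using pq w by (intro class_eq word_cong.append word_cong.rel word_cong.refl)
      then show ?thesis using pq w by (simp add: f_class del: in_lists_conv_set)
    qed (simp add: f_other)
  qed
  then have "?C (u @ []) = ?C (v @ [])"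
    using eq u v f_class by (metis lists.Nil)
  then show ?thesis
    using v unfolding word_class_def using word_cong.refl by fastforce
qed

lemma foldr_concat_map: "foldr f (concat (map g w)) = foldr (\<lambda>a. foldr f (g a)) w"
  by (induction w) auto

lemma concat_map_in_lists:
  assumes "\<And>a. a \<in> A \<Longrightarrow> g a \<in> lists B" "w \<in> lists A"
  shows "concat (map g w) \<in> lists B"
  using assms(2,1) by (induction w) auto

lemma word_cong_concat_map:
  fixes S :: "('b list \<times> 'b list) set"
  assumes "\<And>a. a \<in> A \<Longrightarrow> g a \<in> lists B"
    and "\<And>f :: 'b \<Rightarrow> 'b list set \<Rightarrow> 'b list set.
      satisfies f B S \<Longrightarrow> satisfies (\<lambda>a. foldr f (g a)) A R"
    and uv: "(u, v) \<in> word_cong A R"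
  shows "(concat (map g u), concat (map g v)) \<in> word_cong B S"
proof (rule foldr_eq_imp_word_cong)
  show "concat (map g u) \<in> lists B" "concat (map g v) \<in> lists B"
    using word_cong_in_lists[OF uv] assms(1) concat_map_in_lists by blast+
qed (use assms(2) uv in \<open>auto simp: foldr_concat_map intro: word_cong_imp_foldr_eq\<close>)

text \<open>
  Both translations respect the relations and they are inverse to each other on generators, so they
  induce mutually inverse homomorphisms. All hypotheses are tested in actions; it suffices to consider
  actions on sets of words, since the presented monoids act on these.
\<close>

proposition admits_presentation_by_mutual_translation:
  fixes A :: "'a set" and B :: "'b set" and \<phi> :: "'a \<Rightarrow> 'b list" and \<psi> :: "'b \<Rightarrow> 'a list"
  assumes \<phi>: "\<And>a. a \<in> A \<Longrightarrow> \<phi> a \<in> lists B"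
    and \<psi>: "\<And>b. b \<in> B \<Longrightarrow> \<psi> b \<in> lists A"
    and \<phi>_rels: "\<And>f :: 'b \<Rightarrow> 'b list set \<Rightarrow> 'b list set.
      satisfies f B S \<Longrightarrow> satisfies (\<lambda>a. foldr f (\<phi> a)) A R"
    and \<psi>_rels: "\<And>f :: 'a \<Rightarrow> 'a list set \<Rightarrow> 'a list set.
      satisfies f A R \<Longrightarrow> satisfies (\<lambda>b. foldr f (\<psi> b)) B S"
    and \<psi>\<phi>: "\<And>(f :: 'a \<Rightarrow> 'a list set \<Rightarrow> 'a list set) a.
      satisfies f A R \<Longrightarrow> a \<in> A \<Longrightarrow> foldr (\<lambda>b. foldr f (\<psi> b)) (\<phi> a) = f a"
    and \<phi>\<psi>: "\<And>(f :: 'b \<Rightarrow> 'b list set \<Rightarrow> 'b list set) b.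
      satisfies f B S \<Longrightarrow> b \<in> B \<Longrightarrow> foldr (\<lambda>a. foldr f (\<phi> a)) (\<psi> b) = f b"
  shows "admits_presentation (presented_monoid B S) (\<lambda>a. word_class B S (\<phi> a)) A R"
proof -
  let ?P = "presented_monoid A R" and ?Q = "presented_monoid B S"
  let ?\<Phi> = "\<lambda>w. concat (map \<phi> w)" and ?\<Psi> = "\<lambda>w. concat (map \<psi> w)"
  have \<Phi>_lists: "?\<Phi> w \<in> lists B" if "w \<in> lists A" for w
    using \<phi> that by (rule concat_map_in_lists)
  have \<Psi>_lists: "?\<Psi> w \<in> lists A" if "w \<in> lists B" for w
    using \<psi> that by (rule concat_map_in_lists)
  have \<Phi>_cong: "(?\<Phi> u, ?\<Phi> v) \<in> word_cong B S" if "(u, v) \<in> word_cong A R" for u v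
    using \<phi> \<phi>_rels that by (rule word_cong_concat_map)
  have \<Psi>_cong: "(?\<Psi> u, ?\<Psi> v) \<in> word_cong A R" if "(u, v) \<in> word_cong B S" for u v
    using \<psi> \<psi>_rels that by (rule word_cong_concat_map)
  have \<Psi>\<Phi>: "(?\<Psi> (?\<Phi> w), w) \<in> word_cong A R" if w: "w \<in> lists A" for w
  proof (rule foldr_eq_imp_word_cong)
    fix f :: "'a \<Rightarrow> 'a list set \<Rightarrow> 'a list set"
    assume "satisfies f A R"
    with w show "foldr f (?\<Psi> (?\<Phi> w)) = foldr f w"
      unfolding foldr_concat_map by (induction w) (auto simp: \<psi>\<phi>)
  qed (use w \<Psi>_lists \<Phi>_lists in blast)+
  have \<Phi>\<Psi>: "(?\<Phi> (?\<Psi> w), w) \<in> word_cong B S" if w: "w \<in> lists B" for w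
  proof (rule foldr_eq_imp_word_cong)
    fix f :: "'b \<Rightarrow> 'b list set \<Rightarrow> 'b list set"
    assume "satisfies f B S"
    with w show "foldr f (?\<Phi> (?\<Psi> w)) = foldr f w"
      unfolding foldr_concat_map by (induction w) (auto simp: \<phi>\<psi>)
  qed (use w \<Psi>_lists \<Phi>_lists in blast)+
  have class_eq_A: "word_class A R u = word_class A R v \<longleftrightarrow> (u, v) \<in> word_cong A R"
    if "u \<in> lists A" "v \<in> lists A" for u v
    using that unfolding word_class_def by (intro eq_equiv_class_iff[OF equiv_word_cong])
  have class_eq_B: "word_class B S u = word_class B S v \<longleftrightarrow> (u, v) \<in> word_cong B S"
    if "u \<in> lists B" "v \<in> lists B" for u v
    using that unfolding word_class_def by (intro eq_equiv_class_iff[OF equiv_word_cong])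
  define F where "F X = (\<Union>u\<in>X. word_class B S (?\<Phi> u))" for X
  have F: "F (word_class A R w) = word_class B S (?\<Phi> w)" if w: "w \<in> lists A" for w
  proof -
    have "word_class B S (?\<Phi> u) = word_class B S (?\<Phi> w)" if "u \<in> word_class A R w" for u
      using that \<Phi>_cong[of w u] class_eq_B \<Phi>_lists word_cong_in_lists
      by (metis Image_singleton_iff word_class_def)
    moreover have "w \<in> word_class A R w"
      using w by (simp add: word_class_def word_cong.refl)
    ultimately show ?thesis unfolding F_def by blast
  qed
  have "F \<in> iso ?P ?Q"
    unfolding iso_def
  proof (intro CollectI conjI homI)
    show "F X \<in> carrier ?Q" if "X \<in> carrier ?P" for X
      using that F \<Phi>_lists unfolding carrier_presented_monoid by fastforce
  next
    fix X Y assume "X \<in> carrier ?P" "Y \<in> carrier ?P"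
    then obtain u v where "u \<in> lists A" "v \<in> lists A"
      "X = word_class A R u" "Y = word_class A R v"
      unfolding carrier_presented_monoid by blast
    then show "F (X \<otimes>\<^bsub>?P\<^esub> Y) = F X \<otimes>\<^bsub>?Q\<^esub> F Y"
      using \<Phi>_lists[of u] \<Phi>_lists[of v] F[of "u @ v"]
      by (simp add: F word_class_mult del: in_lists_conv_set)
  next
    show "bij_betw F (carrier ?P) (carrier ?Q)"
      unfolding carrier_presented_monoid
    proof (rule bij_betw_imageI)
      show "inj_on F (word_class A R ` lists A)"
      proof (rule inj_onI, elim imageE)
        fix X Y u v assume uv: "u \<in> lists A" "v \<in> lists A"
          and XY: "X = word_class A R u" "Y = word_class A R v" and "F X = F Y"
        then have "(?\<Phi> u, ?\<Phi> v) \<in> word_cong B S"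
          using class_eq_B \<Phi>_lists F by simp
        from \<Psi>_cong[OF this] have "(u, v) \<in> word_cong A R"
          using \<Psi>\<Phi> uv by (meson word_cong.sym word_cong.trans)
        then show "X = Y" using class_eq_A uv XY by simp
      qed
      show "F ` word_class A R ` lists A = word_class B S ` lists B"
      proof
        show "F ` word_class A R ` lists A \<subseteq> word_class B S ` lists B"
          using F \<Phi>_lists by fastforce
        have "word_class B S w \<in> F ` word_class A R ` lists A" if w: "w \<in> lists B" for w
        proof -
          have "word_class B S w = word_class B S (?\<Phi> (?\<Psi> w))"
            using class_eq_B \<Phi>\<Psi>[OF w] word_cong_in_lists by blast
          also have "\<dots> = F (word_class A R (?\<Psi> w))" using F \<Psi>_lists w by simp
          finally show ?thesis using \<Psi>_lists w by blast
        qed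
        then show "word_class B S ` lists B \<subseteq> F ` word_class A R ` lists A" by blast
      qed
    qed
  qed
  moreover have "F (word_class A R [a]) = word_class B S (\<phi> a)" if "a \<in> A" for a
    using F[of "[a]"] that by simp
  ultimately show ?thesis unfolding admits_presentation_def by blast
qed

section \<open>Conjugate families over the symmetric group\<close>

locale symmetric_action =
  fixes n :: nat and \<nu> :: "nat \<Rightarrow> 'x \<Rightarrow> 'x"
  assumes invol: "0 < i \<Longrightarrow> i < n \<Longrightarrow> \<nu> i (\<nu> i y) = y"
    and braid: "0 < i \<Longrightarrow> Suc i < n \<Longrightarrow>
      \<nu> i (\<nu> (Suc i) (\<nu> i y)) = \<nu> (Suc i) (\<nu> i (\<nu> (Suc i) y))"
    and far: "0 < i \<Longrightarrow> i + 2 \<le> j \<Longrightarrow> j < n \<Longrightarrow> \<nu> i (\<nu> j y) = \<nu> j (\<nu> i y)"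

locale conjugate_family = symmetric_action +
  fixes x :: "nat \<Rightarrow> 'a \<Rightarrow> 'a"
  assumes step: "0 < i \<Longrightarrow> Suc i < n \<Longrightarrow>
      x (Suc i) y = \<nu> i (\<nu> (Suc i) (x i (\<nu> (Suc i) (\<nu> i y))))"
    and base: "3 \<le> k \<Longrightarrow> k < n \<Longrightarrow> \<nu> k (x 1 y) = x 1 (\<nu> k y)"
begin

text \<open>
  The recursion for $x_i$ involves only $\nu_{i-1}$ and $\nu_i$, so a distant $\nu_k$ passes through it
  by induction, unless $k = i-2$. In that case two steps of the recursion give
  $x_{k+2} = w\,x_k\,w^{-1}$ with $w = \nu_{k+1}\nu_{k+2}\nu_k\nu_{k+1}$, and $\nu_k w = w\nu_{k+2}$
  turns $\nu_k$ into $\nu_{k+2}$, which commutes with $x_k$ by induction.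
\<close>

lemma commute_nu:
  assumes "0 < i" "i < n" "0 < k" "k < n" "i + 2 \<le> k \<or> k + 2 \<le> i"
  shows "\<nu> k (x i y) = x i (\<nu> k y)"
  using assms
proof (induction i arbitrary: k y rule: less_induct)
  case (less i)
  show ?case
  proof (cases "i = 1")
    case True
    with less.prems show ?thesis using base by auto
  next
    case False
    with less.prems obtain j where j: "i = Suc j" "0 < j" by (cases i) auto
    show ?thesis
    proof (cases "k + 2 = i")
      case False
      have "\<nu> k (\<nu> l z) = \<nu> l (\<nu> k z)" if "l = j \<or> l = i" for l z
        using that less.prems False j far[of k l z] far[of l k z] by auto
      moreover have "\<nu> k (x j z) = x j (\<nu> k z)" for z
        using less.prems False j by (intro less.IH) auto
      ultimately show ?thesis using less.prems j by (simp add: step)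
    next
      case True
      let ?a = "\<nu> k" and ?b = "\<nu> j" and ?c = "\<nu> i"
      have jk: "j = Suc k" using True j by simp
      have ab: "?a (?b (?a z)) = ?b (?a (?b z))" and bc: "?b (?c (?b z)) = ?c (?b (?c z))"
        and ac: "?a (?c z) = ?c (?a z)" for z
        using less.prems j jk braid[of k] braid[of j] far[of k i] by auto
      have c: "?c (x k z) = x k (?c z)" for z
        using less.prems j jk by (intro less.IH) auto
      have "x i z = ?b (?c (?a (?b (x k (?b (?a (?c (?b z))))))))" for z
        using less.prems j jk by (simp add: step)
      moreover have "?a (?b (?c (?a (?b z)))) = ?b (?c (?a (?b (?c z))))" for z
        using ab bc ac by metis
      moreover have "?c (?b (?a (?c (?b z)))) = ?b (?a (?c (?b (?a z))))" for z
        using ab bc ac by metis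
      ultimately show ?thesis using c by metis
    qed
  qed
qed

lemma step_intertwines:
  assumes "0 < i" "Suc i < n"
  shows "x (Suc i) (\<nu> i (\<nu> (Suc i) y)) = \<nu> i (\<nu> (Suc i) (x i y))"
  using assms by (simp add: step invol)

lemma mixed:
  assumes "0 < i" "Suc i < n"
  shows "\<nu> i (x (Suc i) (\<nu> i y)) = \<nu> (Suc i) (x i (\<nu> (Suc i) y))"
  using assms by (simp add: step invol)

text \<open>
  Conjugation by $\nu_i\nu_{i+1}\nu_{i+2}$ raises the indices $i$ and $i+1$ simultaneously, whereas
  $\nu_i\nu_{i+1}$ only raises $i$. This is what transports a relation between neighbours.
\<close>

lemma shift_intertwines:
  assumes "0 < i" "i + 2 < n"
  shows "x (Suc i) (\<nu> i (\<nu> (Suc i) (\<nu> (i + 2) y))) = \<nu> i (\<nu> (Suc i) (\<nu> (i + 2) (x i y)))"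
    and "x (i + 2) (\<nu> i (\<nu> (Suc i) (\<nu> (i + 2) y))) = \<nu> i (\<nu> (Suc i) (\<nu> (i + 2) (x (Suc i) y)))"
  using assms step_intertwines[of i] step_intertwines[of "Suc i"]
    commute_nu[of i "i + 2"] commute_nu[of "i + 2" i, symmetric] by simp_all

text \<open>
  The permutation $(1\,3)(2\,4)$, an involution that exchanges the pairs $(1,2)$ and $(3,4)$, hence the
  indices 1 and 3.
\<close>

abbreviation swap :: "'a \<Rightarrow> 'a" where
  "swap y \<equiv> \<nu> 2 (\<nu> 1 (\<nu> 3 (\<nu> 2 y)))"

lemma x2: "2 < n \<Longrightarrow> x 2 y = \<nu> 1 (\<nu> 2 (x 1 (\<nu> 2 (\<nu> 1 y))))"
  using step[of 1] by (simp add: numeral_2_eq_2)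

lemma x3:
  assumes "3 < n"
  shows "x 3 y = swap (x 1 (swap y))"
proof -
  have "x 3 y = \<nu> 2 (\<nu> 3 (x 2 (\<nu> 3 (\<nu> 2 y))))"
    using step[of 2] assms by (simp add: numeral_3_eq_3)
  then show ?thesis using x2 far[of 1 3] assms by simp
qed

lemma swap_swap:
  assumes "3 < n"
  shows "swap (swap y) = y"
  using assms invol[of 1] invol[of 2] invol[of 3] far[of 1 3] by simp

lemma swap_conj_nu_1:
  assumes "3 < n"
  shows "swap (\<nu> 1 (swap y)) = \<nu> 3 y"
proof -
  have "\<nu> 1 (\<nu> 1 z) = z" and "\<nu> 2 (\<nu> 2 z) = z" and "\<nu> 3 (\<nu> 3 z) = z"
    and "\<nu> 3 (\<nu> 2 (\<nu> 3 z)) = \<nu> 2 (\<nu> 3 (\<nu> 2 z))"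
    and "\<nu> 1 (\<nu> 2 (\<nu> 1 z)) = \<nu> 2 (\<nu> 1 (\<nu> 2 z))"
    and "\<nu> 3 (\<nu> 1 z) = \<nu> 1 (\<nu> 3 z)" for z
    using assms invol[of 1] invol[of 2] invol[of 3] far[of 1 3] braid[of 1] braid[of 2]
    by (simp_all add: numeral_2_eq_2 numeral_3_eq_3)
  then show ?thesis by metis
qed

text \<open>
  For $x = s$ this is the third connecting string: the conjugate of $\mu_1 = s_1\nu_1$ by
  $\nu_2\nu_1\nu_3\nu_2$ is $\mu_3 = s_3\nu_3$.
\<close>

lemma swap_conj_x1_nu:
  assumes "3 < n"
  shows "swap (x 1 (\<nu> 1 (swap y))) = x 3 (\<nu> 3 y)"
proof -
  have "swap (x 1 (\<nu> 1 (swap y))) = swap (x 1 (swap (swap (\<nu> 1 (swap y)))))"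
    using swap_swap assms by simp
  then show ?thesis using swap_conj_nu_1 x3 assms by simp
qed

end

text \<open>
  From the pair $(1,3)$ one first raises the second index and then the first; the $\nu$'s of the
  recursion step are each time distant from the other index.
\<close>

lemma conjugate_families_commute:
  assumes "conjugate_family n \<nu> x" "conjugate_family n \<nu> z"
    and base: "3 < n \<Longrightarrow> \<forall>y. x 1 (z 3 y) = z 3 (x 1 y)"
    and ij: "0 < i" "i + 2 \<le> j" "j < n"
  shows "x i (z j y) = z j (x i y)"
proof -
  interpret x: conjugate_family n \<nu> x by fact
  interpret z: conjugate_family n \<nu> z by fact
  have x1: "x 1 (z j y) = z j (x 1 y)" if "3 \<le> j" "j < n" for j y
    using that
  proof (induction j arbitrary: y rule: dec_induct)
    case base
    then show ?case using assms(3) by simp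
  next
    case (step j)
    then show ?case
      using x.base[of j, symmetric] x.base[of "Suc j", symmetric] by (simp add: z.step)
  qed
  show ?thesis
    using ij
  proof (induction i arbitrary: y)
    case (Suc i)
    show ?case
    proof (cases "i = 0")
      case True
      with Suc.prems show ?thesis using x1[of j] by simp
    next
      case False
      with Suc show ?thesis
        using z.commute_nu[of j i] z.commute_nu[of j "Suc i"] by (simp add: x.step)
    qed
  qed simp
qed

locale conjugate_families =
  s: conjugate_family n \<nu> s + t: conjugate_family n \<nu> t
  for n and \<nu> s t :: "nat \<Rightarrow> 'x \<Rightarrow> 'x"
begin

text \<open>
  With $\mu_i = s_i\nu_i$ and $\gamma_i = t_i\nu_i$, the left side of the equivalence is $\mu_1\gamma_3 = \gamma_3\mu_1$. Both
  of its sides end in the invertible factor $\nu_1\nu_3$ once the $\nu$'s are moved to the right.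
\<close>

lemma far_relation_iff:
  assumes "3 < n"
  shows "(\<forall>y. s 1 (\<nu> 1 (s.swap (t 1 (\<nu> 1 (s.swap y))))) = s.swap (t 1 (\<nu> 1 (s.swap (s 1 (\<nu> 1 y))))))
    \<longleftrightarrow> (\<forall>y. s 1 (t 3 y) = t 3 (s 1 y))"
proof -
  let ?c = "\<lambda>y. \<nu> 1 (\<nu> 3 y)"
  have "s 1 (\<nu> 1 (s.swap (t 1 (\<nu> 1 (s.swap y))))) = s 1 (t 3 (?c y))" for y
    using assms t.swap_conj_x1_nu t.commute_nu[of 3 1] by simp
  moreover have "s.swap (t 1 (\<nu> 1 (s.swap (s 1 (\<nu> 1 y))))) = t 3 (s 1 (?c y))" for y
    using assms t.swap_conj_x1_nu s.base[of 3] s.far[of 1 3] by simp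
  moreover have "?c (?c y) = y" for y
    using assms s.invol[of 1] s.invol[of 3] s.far[of 1 3] by simp
  ultimately show ?thesis by metis
qed

text \<open>
  The reduced form of the twin relation, with $\mu_1 = s_1\nu_1$ and $\gamma_1 = t_1\nu_1$ inserted. Its
  two sides are $s_2s_1t_2$ and $t_1s_2s_1$, each multiplied by the involution
  $\nu_1\nu_2\nu_1$ on the right.
\<close>

lemma twin_relation_iff:
  assumes "2 < n"
  shows "(\<forall>y. \<nu> 1 (\<nu> 2 (s 1 (\<nu> 1 (\<nu> 2 (\<nu> 1 (\<nu> 2 (s 1 (\<nu> 1 (\<nu> 2 (t 1 (\<nu> 1 y)))))))))))
      = t 1 (\<nu> 1 (\<nu> 2 (s 1 (\<nu> 1 (\<nu> 2 (\<nu> 1 (\<nu> 2 (s 1 (\<nu> 1 (\<nu> 2 (\<nu> 1 y))))))))))))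
    \<longleftrightarrow> (\<forall>y. s 2 (s 1 (t 2 y)) = t 1 (s 2 (s 1 y)))"
    (is "(\<forall>y. ?l y = ?r y) \<longleftrightarrow> _")
proof -
  let ?c = "\<lambda>y. \<nu> 1 (\<nu> 2 (\<nu> 1 y))"
  have inv: "\<nu> 1 (\<nu> 1 y) = y" "\<nu> 2 (\<nu> 2 y) = y" for y
    using assms s.invol by simp_all
  have braid: "\<nu> 1 (\<nu> 2 (\<nu> 1 y)) = \<nu> 2 (\<nu> 1 (\<nu> 2 y))" for y
    using assms s.braid[of 1] by (simp add: numeral_2_eq_2)
  have order_3: "\<nu> 1 (\<nu> 2 (\<nu> 1 (\<nu> 2 y))) = \<nu> 2 (\<nu> 1 y)" for y
    using braid inv by metis
  have "?l y = s 2 (s 1 (t 2 (?c y)))" for y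
    using assms inv braid order_3 by (simp add: s.x2 t.x2 del: One_nat_def)
  moreover have "?r y = t 1 (s 2 (s 1 (?c y)))" for y
    using assms inv braid order_3 by (simp add: s.x2 t.x2 del: One_nat_def)
  moreover have "?c (?c y) = y" for y
    using inv by simp
  ultimately show ?thesis by metis
qed

end

text \<open>
  The common normal form of both presentations: the families $s$ and $t$ (for $\tau$) are determined by
  their first members, and the other relations are imposed only where they involve the lowest indices.
\<close>

locale twin_action = conjugate_families +
  assumes s1_s1: "1 < n \<Longrightarrow> s 1 (s 1 y) = y"
    and twin1: "2 < n \<Longrightarrow> s 2 (s 1 (t 2 y)) = t 1 (s 2 (s 1 y))"
    and t1_s1: "1 < n \<Longrightarrow> t 1 (s 1 y) = s 1 (t 1 y)"
    and t1_t3: "3 < n \<Longrightarrow> t 1 (t 3 y) = t 3 (t 1 y)"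
    and t1_s3: "3 < n \<Longrightarrow> t 1 (s 3 y) = s 3 (t 1 y)"
    and s1_s3: "3 < n \<Longrightarrow> s 1 (s 3 y) = s 3 (s 1 y)"
begin

lemma s_s:
  assumes "0 < i" "i < n"
  shows "s i (s i y) = y"
  using assms
proof (induction i arbitrary: y)
  case (Suc i)
  then show ?case
    using s1_s1 by (cases "i = 0") (simp_all add: s.step s.invol)
qed simp

lemma t_s:
  assumes "0 < i" "i < n"
  shows "t i (s i y) = s i (t i y)"
  using assms
proof (induction i arbitrary: y)
  case (Suc i)
  then show ?case
    using t1_s1 by (cases "i = 0") (simp_all add: s.step t.step s.invol)
qed simp

lemma twin:
  assumes "0 < i" "Suc i < n"
  shows "s (Suc i) (s i (t (Suc i) y)) = t i (s (Suc i) (s i y))"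
  using assms
proof (induction i arbitrary: y)
  case (Suc i)
  show ?case
  proof (cases "i = 0")
    case True
    then show ?thesis using twin1 Suc.prems by (simp add: numeral_2_eq_2)
  next
    case False
    (* Both sides at index i + 1 are the sides at index i, conjugated by this product. *)
    let ?w = "\<lambda>z. \<nu> i (\<nu> (Suc i) (\<nu> (i + 2) z))"
    define z where "z = \<nu> (i + 2) (\<nu> (Suc i) (\<nu> i y))"
    have y: "y = ?w z" using False Suc.prems by (simp add: z_def s.invol)
    show ?thesis
      using False Suc s.shift_intertwines[of i] t.shift_intertwines[of i]
      unfolding y by simp
  qed
qed simp

text \<open>
  The original presentation contains the relation for both orders of neighbouring indices. As the $s_i$
  are involutions, one order is the other one multiplied by $s_is_{i+1}$ from both sides.
\<close>

lemma twin_flipped: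
  assumes "0 < i" "Suc i < n"
  shows "s i (s (Suc i) (t i y)) = t (Suc i) (s i (s (Suc i) y))"
proof -
  have "t i y = s (Suc i) (s i (t (Suc i) (s i (s (Suc i) y))))"
    using assms by (simp add: twin s_s)
  then show ?thesis using assms by (simp add: s_s)
qed

text \<open>
  Conjugation by \<open>swap\<close> exchanges the indices in the commutation of $t_1$ with $s_3$.
\<close>

lemma s1_t3:
  assumes "3 < n"
  shows "s 1 (t 3 y) = t 3 (s 1 y)"
proof -
  have "s 1 (s.swap z) = s.swap (s 3 z)" for z
    using s.x3 s.swap_swap assms by simp
  moreover have "t 3 (s.swap z) = s.swap (t 1 z)" for z
    using t.x3 s.swap_swap assms by simp
  ultimately have "s 1 (t 3 (s.swap z)) = t 3 (s 1 (s.swap z))" for z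
    using t1_s3 assms by simp
  then show ?thesis using s.swap_swap assms by metis
qed

lemma s_s_far: "0 < i \<Longrightarrow> i + 2 \<le> j \<Longrightarrow> j < n \<Longrightarrow> s i (s j y) = s j (s i y)"
  using conjugate_families_commute[OF s.conjugate_family_axioms s.conjugate_family_axioms] s1_s3
  by blast

lemma s_t_far: "0 < i \<Longrightarrow> i + 2 \<le> j \<Longrightarrow> j < n \<Longrightarrow> s i (t j y) = t j (s i y)"
  using conjugate_families_commute[OF s.conjugate_family_axioms t.conjugate_family_axioms] s1_t3
  by blast

lemma t_s_far: "0 < i \<Longrightarrow> i + 2 \<le> j \<Longrightarrow> j < n \<Longrightarrow> t i (s j y) = s j (t i y)"
  using conjugate_families_commute[OF t.conjugate_family_axioms s.conjugate_family_axioms] t1_s3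
  by blast

lemma t_t_far: "0 < i \<Longrightarrow> i + 2 \<le> j \<Longrightarrow> j < n \<Longrightarrow> t i (t j y) = t j (t i y)"
  using conjugate_families_commute[OF t.conjugate_family_axioms t.conjugate_family_axioms] t1_t3
  by blast

end

section \<open>Both presentations describe the same actions\<close>

lemma satisfies_family:
  "satisfies f A {(u i, v i) |i. P i} \<longleftrightarrow>
    (\<forall>i. P i \<longrightarrow> u i \<in> lists A \<longrightarrow> v i \<in> lists A \<longrightarrow> (\<forall>y. foldr f (u i) y = foldr f (v i) y))"
  unfolding satisfies_def by (auto simp: fun_eq_iff)

lemma satisfies_family2:
  "satisfies f A {(u i j, v i j) |i j. P i j} \<longleftrightarrow>
    (\<forall>i j. P i j \<longrightarrow> u i j \<in> lists A \<longrightarrow> v i j \<in> lists A \<longrightarrow>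
      (\<forall>y. foldr f (u i j) y = foldr f (v i j) y))"
  unfolding satisfies_def by (fastforce simp: fun_eq_iff)

lemma satisfies_single:
  "satisfies f A {(u, v)} \<longleftrightarrow>
    (u \<in> lists A \<longrightarrow> v \<in> lists A \<longrightarrow> (\<forall>y. foldr f u y = foldr f v y))"
  unfolding satisfies_def by (auto simp: fun_eq_iff)

lemma adjacent_iff: "\<bar>int i - int j\<bar> = 1 \<longleftrightarrow> j = Suc i \<or> i = Suc j"
  by auto

lemma distant_iff: "\<bar>int i - int j\<bar> \<ge> 2 \<longleftrightarrow> i + 2 \<le> j \<or> j + 2 \<le> i"
  by auto

text \<open>
  When the two sides of a relation arise from each other by exchanging the indices, the family contains
  each relation twice, once in either direction.
\<close>

lemma satisfies_adjacent:
  "satisfies f A {(w i j, w j i) |i j. \<bar>int i - int j\<bar> = 1} \<longleftrightarrow>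
    (\<forall>i. w i (Suc i) \<in> lists A \<longrightarrow> w (Suc i) i \<in> lists A \<longrightarrow>
      (\<forall>y. foldr f (w i (Suc i)) y = foldr f (w (Suc i) i) y))"
  unfolding satisfies_family2 adjacent_iff by metis

lemma satisfies_distant:
  "satisfies f A {(w i j, w j i) |i j. \<bar>int i - int j\<bar> \<ge> 2} \<longleftrightarrow>
    (\<forall>i j. i + 2 \<le> j \<longrightarrow> w i j \<in> lists A \<longrightarrow> w j i \<in> lists A \<longrightarrow>
      (\<forall>y. foldr f (w i j) y = foldr f (w j i) y))"
  unfolding satisfies_family2 distant_iff by metis

text \<open>
  From right to left, this is where the relations of lowest index yield all others.
\<close>

lemma satisfies_vstm_rels_iff:
  "satisfies f (vstm_gens n) vstm_rels \<longleftrightarrow>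
    twin_action n (\<lambda>i. f (Nu i)) (\<lambda>i. f (Sg i)) (\<lambda>i. f (Tau i))"
  (is "?sat \<longleftrightarrow> ?twin")
proof -
  have gens: "Sg i \<in> vstm_gens n \<longleftrightarrow> 0 < i \<and> i < n" "Tau i \<in> vstm_gens n \<longleftrightarrow> 0 < i \<and> i < n"
    "Nu i \<in> vstm_gens n \<longleftrightarrow> 0 < i \<and> i < n" for i
    by (auto simp: vstm_gens_def)
  let ?far = "{([g i, h j], [h j, g i]) |g h i j.
    g \<in> {Sg, Tau, Nu} \<and> h \<in> {Sg, Tau, Nu} \<and> \<bar>int i - int j\<bar> \<ge> 2}"
  note unfold_rels = vstm_rels_def satisfies_Un satisfies_family satisfies_family2 adjacent_iff
  show ?thesis
  proof
    assume ?sat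
    note far = this[unfolded vstm_rels_def satisfies_Un, THEN conjunct2]
    have rel: "foldr f u y = foldr f v y"
      if "(u, v) \<in> vstm_rels" "\<forall>x\<in>set u \<union> set v. x \<in> vstm_gens n" for u v y
      using satisfiesD[OF \<open>?sat\<close> that(1)] that(2) by auto
    have invol: "f (Nu i) (f (Nu i) y) = y" if "0 < i" "i < n" for i y
      using rel[of "[Nu i, Nu i]" "[]" y] that by (simp add: vstm_rels_def gens)
    have adjacent: "f (Nu i) (f (Nu (Suc i)) (f (Nu i) y)) = f (Nu (Suc i)) (f (Nu i) (f (Nu (Suc i)) y))"
      "f (Nu i) (f (Sg (Suc i)) (f (Nu i) y)) = f (Nu (Suc i)) (f (Sg i) (f (Nu (Suc i)) y))"
      "f (Nu i) (f (Tau (Suc i)) (f (Nu i) y)) = f (Nu (Suc i)) (f (Tau i) (f (Nu (Suc i)) y))"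
      "f (Sg (Suc i)) (f (Sg i) (f (Tau (Suc i)) y)) = f (Tau i) (f (Sg (Suc i)) (f (Sg i) y))"
      if "0 < i" "Suc i < n" for i y
      using rel[of "[Nu i, Nu (Suc i), Nu i]" "[Nu (Suc i), Nu i, Nu (Suc i)]" y]
        rel[of "[Nu i, Sg (Suc i), Nu i]" "[Nu (Suc i), Sg i, Nu (Suc i)]" y]
        rel[of "[Nu i, Tau (Suc i), Nu i]" "[Nu (Suc i), Tau i, Nu (Suc i)]" y]
        rel[of "[Sg (Suc i), Sg i, Tau (Suc i)]" "[Tau i, Sg (Suc i), Sg i]" y] that
      by (simp_all add: vstm_rels_def gens)
    have distant: "f (g i) (f (h j) y) = f (h j) (f (g i) y)"
      if "g \<in> {Sg, Tau, Nu}" "h \<in> {Sg, Tau, Nu}" "0 < i" "i + 2 \<le> j" "j < n" for g h i j y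
    proof -
      have "([g i, h j], [h j, g i]) \<in> ?far"
        using that by (intro CollectI exI[of _ g] exI[of _ h] exI[of _ i] exI[of _ j]) auto
      moreover have "[g i, h j] \<in> lists (vstm_gens n)" "[h j, g i] \<in> lists (vstm_gens n)"
        using that by (auto simp: gens)
      ultimately show ?thesis
        using satisfiesD[OF far, of "[g i, h j]" "[h j, g i]" y] by simp
    qed
    have step: "f (g (Suc i)) y = f (Nu i) (f (Nu (Suc i)) (f (g i) (f (Nu (Suc i)) (f (Nu i) y))))"
      if "g = Sg \<or> g = Tau" "0 < i" "Suc i < n" for g i y
      using that invol adjacent(2,3)[of i "f (Nu i) y", symmetric] by auto
    show ?twin
    proof
      show "f (Sg 1) (f (Sg 1) y) = y" "f (Tau 1) (f (Sg 1) y) = f (Sg 1) (f (Tau 1) y)" if "1 < n" for y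
        using rel[of "[Sg 1, Sg 1]" "[]" y] rel[of "[Tau 1, Sg 1]" "[Sg 1, Tau 1]" y] that
        by (simp_all add: vstm_rels_def gens)
      show "f (Sg 2) (f (Sg 1) (f (Tau 2) y)) = f (Tau 1) (f (Sg 2) (f (Sg 1) y))" if "2 < n" for y
        using adjacent(4)[of 1] that by (simp add: numeral_2_eq_2)
      show "f (Nu k) (f (Sg 1) y) = f (Sg 1) (f (Nu k) y)" "f (Nu k) (f (Tau 1) y) = f (Tau 1) (f (Nu k) y)"
        if "3 \<le> k" "k < n" for k y
        using distant[of Sg Nu 1 k] distant[of Tau Nu 1 k] that by simp_all
    qed (use invol adjacent(1) distant[of Nu Nu] distant[of Sg Sg 1 3] distant[of Tau Sg 1 3]
      distant[of Tau Tau 1 3] step[of Sg] step[of Tau] in simp_all)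
  next
    assume ?twin
    then interpret twin_action n "\<lambda>i. f (Nu i)" "\<lambda>i. f (Sg i)" "\<lambda>i. f (Tau i)" .
    have distant: "f (g i) (f (h j) y) = f (h j) (f (g i) y)"
      if "g \<in> {Sg, Tau, Nu}" "h \<in> {Sg, Tau, Nu}" "0 < i" "i + 2 \<le> j" "j < n" for g h i j y
      using that s_s_far[of i j y] s_t_far[of i j y] t_s_far[of i j y] t_t_far[of i j y] s.far[of i j y]
        s.commute_nu[of j i y] s.commute_nu[of i j y] t.commute_nu[of j i y] t.commute_nu[of i j y]
      by auto
    have "satisfies f (vstm_gens n) ?far"
    proof (rule satisfiesI)
      fix u v y assume "(u, v) \<in> ?far" and lists: "u \<in> lists (vstm_gens n)"
      then obtain g h i j where uv: "u = [g i, h j]" "v = [h j, g i]"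
        and gh: "g \<in> {Sg, Tau, Nu}" "h \<in> {Sg, Tau, Nu}" and ij: "\<bar>int i - int j\<bar> \<ge> 2" by blast
      have "0 < i \<and> i < n" "0 < j \<and> j < n" using lists gh by (auto simp: uv gens)
      then have "f (g i) (f (h j) y) = f (h j) (f (g i) y)"
        using ij[unfolded distant_iff] distant[OF gh, of i j] distant[OF gh(2,1), of j i] by metis
      then show "foldr f u y = foldr f v y" by (simp add: uv)
    qed
    then show ?sat
      unfolding unfold_rels
      by (intro conjI) (auto simp: gens s.invol s_s t_s s.braid s.mixed t.mixed twin twin_flipped)
  qed
qed

text \<open>
  The inverse of \<open>\<mu>\<close> is $\nu_1\mu_1\nu_1$, that is $\nu_1s_1$.
\<close>

locale reduced_action = symmetric_action n \<nu> for n and \<nu> :: "nat \<Rightarrow> 'x \<Rightarrow> 'x" +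
  fixes \<mu> \<gamma> :: "'x \<Rightarrow> 'x"
  assumes mu_inv: "1 < n \<Longrightarrow> \<mu> (\<nu> 1 (\<mu> (\<nu> 1 y))) = y"
    and inv_mu: "1 < n \<Longrightarrow> \<nu> 1 (\<mu> (\<nu> 1 (\<mu> y))) = y"
    and twin: "2 < n \<Longrightarrow>
      \<nu> 1 (\<nu> 2 (\<mu> (\<nu> 2 (\<nu> 1 (\<nu> 2 (\<mu> (\<nu> 2 (\<gamma> y))))))))
      = \<gamma> (\<nu> 2 (\<mu> (\<nu> 2 (\<nu> 1 (\<nu> 2 (\<mu> (\<nu> 2 (\<nu> 1 y))))))))"
    and mu_gamma: "1 < n \<Longrightarrow> \<mu> (\<nu> 1 (\<gamma> y)) = \<gamma> (\<nu> 1 (\<mu> y))"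
    and mu_nu: "3 \<le> k \<Longrightarrow> k < n \<Longrightarrow> \<mu> (\<nu> k y) = \<nu> k (\<mu> y)"
    and gamma_nu: "3 \<le> k \<Longrightarrow> k < n \<Longrightarrow> \<gamma> (\<nu> k y) = \<nu> k (\<gamma> y)"
    and gamma_gamma3: "3 < n \<Longrightarrow>
      \<gamma> (\<nu> 2 (\<nu> 1 (\<nu> 3 (\<nu> 2 (\<gamma> (\<nu> 2 (\<nu> 3 (\<nu> 1 (\<nu> 2 y)))))))))
      = \<nu> 2 (\<nu> 1 (\<nu> 3 (\<nu> 2 (\<gamma> (\<nu> 2 (\<nu> 3 (\<nu> 1 (\<nu> 2 (\<gamma> y)))))))))"
    and gamma_mu3: "3 < n \<Longrightarrow>
      \<gamma> (\<nu> 2 (\<nu> 1 (\<nu> 3 (\<nu> 2 (\<mu> (\<nu> 2 (\<nu> 3 (\<nu> 1 (\<nu> 2 y)))))))))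
      = \<nu> 2 (\<nu> 1 (\<nu> 3 (\<nu> 2 (\<mu> (\<nu> 2 (\<nu> 3 (\<nu> 1 (\<nu> 2 (\<gamma> y)))))))))"
    and mu_mu3: "3 < n \<Longrightarrow>
      \<mu> (\<nu> 2 (\<nu> 1 (\<nu> 3 (\<nu> 2 (\<mu> (\<nu> 2 (\<nu> 3 (\<nu> 1 (\<nu> 2 y)))))))))
      = \<nu> 2 (\<nu> 1 (\<nu> 3 (\<nu> 2 (\<mu> (\<nu> 2 (\<nu> 3 (\<nu> 1 (\<nu> 2 (\<mu> y)))))))))"

lemma satisfies_red_rels_iff:
  "satisfies f (red_gens n) red_rels \<longleftrightarrow> reduced_action n (\<lambda>i. f (N i)) (f M1) (f G1)"
proof -
  have gens: "N i \<in> red_gens n \<longleftrightarrow> 0 < i \<and> i < n"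
    "M1 \<in> red_gens n \<longleftrightarrow> 1 < n" "G1 \<in> red_gens n \<longleftrightarrow> 1 < n" for i
    by (auto simp: red_gens_def)
  have braid: "satisfies f (red_gens n) {([N i, N j, N i], [N j, N i, N j]) |i j. \<bar>int i - int j\<bar> = 1}
    \<longleftrightarrow> (\<forall>i>0. Suc i < n \<longrightarrow> (\<forall>y. f (N i) (f (N (Suc i)) (f (N i) y))
        = f (N (Suc i)) (f (N i) (f (N (Suc i)) y))))"
    unfolding satisfies_adjacent by (simp add: gens) (meson Suc_lessD)
  have far: "satisfies f (red_gens n) {([N i, N j], [N j, N i]) |i j. \<bar>int i - int j\<bar> \<ge> 2}
    \<longleftrightarrow> (\<forall>i>0. \<forall>j\<ge>i + 2. j < n \<longrightarrow> (\<forall>y. f (N i) (f (N j) y) = f (N j) (f (N i) y)))"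
    unfolding satisfies_distant
    by (simp add: gens) (meson Suc_leD Suc_le_lessD less_trans zero_less_Suc le_less_trans)
  (* The condition that all letters of a relation exist is a bound on its largest index. *)
  have absorb: "a < n \<and> b < n \<longleftrightarrow> b < n" "b < n \<and> a < n \<longleftrightarrow> b < n"
    "a < n \<and> b < n \<and> Q \<longleftrightarrow> b < n \<and> Q" "b < n \<and> a < n \<and> Q \<longleftrightarrow> b < n \<and> Q" if "a \<le> b" for a b Q
    using that by auto
  have flip: "(\<forall>y. y = g y) \<longleftrightarrow> (\<forall>y. g y = y)" for g :: "'a \<Rightarrow> 'a"
    by metis
  show ?thesis
    unfolding red_rels_def satisfies_Un braid far
    unfolding satisfies_family mu1_inv_def s1_word_def
      insert_is_Un[of _ "{_}"] satisfies_Un satisfies_single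
      reduced_action_def reduced_action_axioms_def symmetric_action_def
    by (simp add: gens absorb flip del: One_nat_def) (simp only: imp_conjL, simp only: conj_ac)
qed

text \<open>
  Given the dictionary $\mu_1 = s_1\nu_1$, $\gamma_1 = t_1\nu_1$, each reduced relation is equivalent to
  one relation of the normal form. The relations that make $s$ and $t$ conjugate families have to be
  compared first, since the other equivalences depend on them.
\<close>

lemma reduced_action_iff_twin_action:
  assumes \<mu>: "1 < n \<Longrightarrow> (\<And>y. \<mu> y = s 1 (\<nu> 1 y))"
    and \<gamma>: "1 < n \<Longrightarrow> (\<And>y. \<gamma> y = t 1 (\<nu> 1 y))"
    and s_step: "\<And>i y. 0 < i \<Longrightarrow> Suc i < n \<Longrightarrow>
      s (Suc i) y = \<nu> i (\<nu> (Suc i) (s i (\<nu> (Suc i) (\<nu> i y))))"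
    and t_step: "\<And>i y. 0 < i \<Longrightarrow> Suc i < n \<Longrightarrow>
      t (Suc i) y = \<nu> i (\<nu> (Suc i) (t i (\<nu> (Suc i) (\<nu> i y))))"
  shows "reduced_action n \<nu> \<mu> \<gamma> \<longleftrightarrow> twin_action n \<nu> s t"
proof (cases "conjugate_families n \<nu> s t")
  case True
  then interpret st: conjugate_families n \<nu> s t .
  interpret ts: conjugate_families n \<nu> t s ..
  interpret ss: conjugate_families n \<nu> s s ..
  interpret tt: conjugate_families n \<nu> t t ..
  have flip: "\<nu> 3 (\<nu> 1 y) = \<nu> 1 (\<nu> 3 y)" if "3 < n" for y
    using st.s.far[of 1 3] that by simp
  have central: "\<forall>y. \<mu> (\<nu> k y) = \<nu> k (\<mu> y)" "\<forall>y. \<gamma> (\<nu> k y) = \<nu> k (\<gamma> y)" if "3 \<le> k" "k < n" for k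
    using that st.s.base st.t.base st.s.far[of 1 k] \<mu> \<gamma> by simp_all
  have square: "(\<forall>y. \<mu> (\<nu> 1 (\<mu> (\<nu> 1 y))) = y) \<longleftrightarrow> (\<forall>y. s 1 (s 1 y) = y)"
    "(\<forall>y. \<nu> 1 (\<mu> (\<nu> 1 (\<mu> y))) = y) \<longleftrightarrow> (\<forall>y. s 1 (s 1 y) = y)" if "1 < n"
  proof -
    have inv: "\<nu> 1 (\<nu> 1 y) = y" for y using that st.s.invol by simp
    show "(\<forall>y. \<mu> (\<nu> 1 (\<mu> (\<nu> 1 y))) = y) \<longleftrightarrow> (\<forall>y. s 1 (s 1 y) = y)"
      using that \<mu> inv by simp
    show "(\<forall>y. \<nu> 1 (\<mu> (\<nu> 1 (\<mu> y))) = y) \<longleftrightarrow> (\<forall>y. s 1 (s 1 y) = y)"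
      unfolding \<mu>[OF that] inv by (metis inv)
  qed
  have comm: "(\<forall>y. \<mu> (\<nu> 1 (\<gamma> y)) = \<gamma> (\<nu> 1 (\<mu> y))) \<longleftrightarrow> (\<forall>y. t 1 (s 1 y) = s 1 (t 1 y))"
    if "1 < n"
  proof -
    have inv: "\<nu> 1 (\<nu> 1 y) = y" for y using that st.s.invol by simp
    show ?thesis unfolding \<mu>[OF that] \<gamma>[OF that] inv by (metis inv)
  qed
  have "reduced_action n \<nu> \<mu> \<gamma> \<longleftrightarrow> twin_action_axioms n s t"
    unfolding reduced_action_def reduced_action_axioms_def twin_action_axioms_def
    using st.s.symmetric_action_axioms square comm central st.twin_relation_iff
      ts.far_relation_iff ss.far_relation_iff tt.far_relation_iff
    by (simp add: \<mu> \<gamma> flip del: One_nat_def)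
  then show ?thesis
    using True unfolding twin_action_def by blast
next
  case False
  have "conjugate_families n \<nu> s t" if "reduced_action n \<nu> \<mu> \<gamma>"
  proof -
    interpret reduced_action n \<nu> \<mu> \<gamma> by (fact that)
    have base: "s 1 y = \<mu> (\<nu> 1 y)" "t 1 y = \<gamma> (\<nu> 1 y)" if "1 < n" for y
      using \<mu> \<gamma> invol that by simp_all
    show ?thesis
    proof
      fix k y assume k: "3 \<le> k" "k < n"
      show "\<nu> k (s 1 y) = s 1 (\<nu> k y)" "\<nu> k (t 1 y) = t 1 (\<nu> k y)"
        using k far[of 1 k] mu_nu gamma_nu by (simp_all add: base del: One_nat_def)
    qed (use s_step t_step in auto)
  qed
  with False show ?thesis unfolding twin_action_def by blast
qed

section \<open>The reduced presentation\<close>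

text \<open>
  The word for $s_i$ or $\tau_i$ obtained from a word \<open>w\<close> for $s_1$ or $\tau_1$. At the index 0, where
  there is no generator, the value is a dummy.
\<close>

primrec transport_word :: "red_gen list \<Rightarrow> nat \<Rightarrow> red_gen list" where
  "transport_word w 0 = []"
| "transport_word w (Suc i) =
    (if i = 0 then w else [N i, N (Suc i)] @ transport_word w i @ [N (Suc i), N i])"

primrec vstm_gen_word :: "vstm_gen \<Rightarrow> red_gen list" where
  "vstm_gen_word (Nu i) = [N i]"
| "vstm_gen_word (Sg i) = transport_word [M1, N 1] i"
| "vstm_gen_word (Tau i) = transport_word [G1, N 1] i"

primrec red_gen_word :: "red_gen \<Rightarrow> vstm_gen list" where
  "red_gen_word (N i) = [Nu i]"
| "red_gen_word M1 = [Sg 1, Nu 1]"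
| "red_gen_word G1 = [Tau 1, Nu 1]"

lemma transport_word_in_lists:
  assumes "w \<in> lists (red_gens n)" "i < n"
  shows "transport_word w i \<in> lists (red_gens n)"
  using assms by (induction i) (auto simp: red_gens_def)

lemma (in conjugate_family) foldr_transport_word:
  assumes "\<And>i. f (N i) = \<nu> i" and "1 < n \<Longrightarrow> foldr f w = x 1" and "0 < i" "i < n"
  shows "foldr f (transport_word w i) = x i"
  using assms(3,4)
proof (induction i)
  case (Suc i)
  then show ?case
    using assms(1,2) by (cases "i = 0") (auto simp: step)
qed simp

theorem theorem33:
  fixes n :: nat
  shows "admits_presentation (VSTM n) (connecting_string n) (red_gens n) red_rels"
proof -
  have "connecting_string n = (\<lambda>a. vstm_elem n (red_gen_word a))"
  proof
    show "connecting_string n a = vstm_elem n (red_gen_word a)" for a by (cases a) simp_all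
  qed
  moreover have "admits_presentation (VSTM n) (\<lambda>a. vstm_elem n (red_gen_word a)) (red_gens n) red_rels"
    unfolding VSTM_def
  proof (rule admits_presentation_by_mutual_translation)
    show "red_gen_word a \<in> lists (vstm_gens n)" if "a \<in> red_gens n" for a
      using that by (auto simp: red_gens_def vstm_gens_def split: if_splits)
    show "vstm_gen_word b \<in> lists (red_gens n)" if "b \<in> vstm_gens n" for b
    proof -
      from that consider i where "b = Nu i" "N i \<in> red_gens n"
        | i where "b = Sg i" "0 < i" "i < n" | i where "b = Tau i" "0 < i" "i < n"
        by (auto simp: vstm_gens_def red_gens_def)
      then show ?thesis
      proof cases
        case 2
        have "[M1, N 1] \<in> lists (red_gens n)" using 2 by (auto simp: red_gens_def)
        then show ?thesis using 2 transport_word_in_lists by simp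
      next
        case 3
        have "[G1, N 1] \<in> lists (red_gens n)" using 3 by (auto simp: red_gens_def)
        then show ?thesis using 3 transport_word_in_lists by simp
      qed simp
    qed
  next
    fix f :: "vstm_gen \<Rightarrow> vstm_gen list set \<Rightarrow> vstm_gen list set"
    assume "satisfies f (vstm_gens n) vstm_rels"
    then interpret twin_action n "\<lambda>i. f (Nu i)" "\<lambda>i. f (Sg i)" "\<lambda>i. f (Tau i)"
      unfolding satisfies_vstm_rels_iff .
    let ?f = "\<lambda>a. foldr f (red_gen_word a)"
    show "satisfies ?f (red_gens n) red_rels"
      unfolding satisfies_red_rels_iff
      by (subst reduced_action_iff_twin_action[where s = "\<lambda>i. f (Sg i)" and t = "\<lambda>i. f (Tau i)"])
        (auto simp: s.step t.step twin_action_axioms)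
    have base: "foldr ?f [M1, N 1] = f (Sg 1)" "foldr ?f [G1, N 1] = f (Tau 1)" if "1 < n"
      using that by (auto simp: comp_def s.invol)
    fix b assume "b \<in> vstm_gens n"
    then consider i where "b = Nu i" | i where "b = Sg i" "0 < i" "i < n"
      | i where "b = Tau i" "0 < i" "i < n"
      by (auto simp: vstm_gens_def)
    then show "foldr ?f (vstm_gen_word b) = f b"
    proof cases
      case 2
      then show ?thesis using s.foldr_transport_word[of ?f, OF _ base(1)] by simp
    next
      case 3
      then show ?thesis using t.foldr_transport_word[of ?f, OF _ base(2)] by simp
    qed auto
  next
    fix f :: "red_gen \<Rightarrow> red_gen list set \<Rightarrow> red_gen list set"
    assume "satisfies f (red_gens n) red_rels"
    then have reduced: "reduced_action n (\<lambda>i. f (N i)) (f M1) (f G1)"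
      unfolding satisfies_red_rels_iff .
    then interpret symmetric_action n "\<lambda>i. f (N i)" unfolding reduced_action_def by blast
    let ?f = "\<lambda>b. foldr f (vstm_gen_word b)"
    show "satisfies ?f (vstm_gens n) vstm_rels"
      unfolding satisfies_vstm_rels_iff
      using reduced
      by (subst (asm) reduced_action_iff_twin_action[where s = "\<lambda>i. ?f (Sg i)" and t = "\<lambda>i. ?f (Tau i)"])
        (auto simp: invol)
    fix a assume "a \<in> red_gens n"
    then show "foldr ?f (red_gen_word a) = f a"
      by (cases a) (auto simp: red_gens_def invol fun_eq_iff split: if_splits)
  qed
  ultimately show ?thesis by simp
qed

end
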